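(* Let $R$ be a ring and let $M$ be a compressible left $R$-module. Suppose that $M$ is indecomposable and injective, and that the kernel of every nonzero partial endomorphism of $M$ is uniform and nonsingular. Then $M$ is critically compressible.
   Context: Rings are associative with identity $1\neq 0$; modules are unitary left modules. A nonzero module $M$ is compressible if for every nonzero submodule $N\le M$ there is a monomorphism $M\to N$. A module $M$ is critically compressible if it is compressible and, in addition, there is no monomorphism $M\to M/N$ for any nonzero submodule $N\le M$. A partial endomorphism of $M$ is a homomorphism from a submodule of $M$ into $M$. A module is uniform if any two nonzero submodules have nonzero intersection (so the zero module counts as uniform). A module $K$ is nonsingular if $Z(K)=0$, where $Z(K)$ is the set of $x\in K$ whose annihilator $\{r\in R: rx=0\}$ is an essential left ideal of $R$. *)

theory Defs
  imports "HOL-Algebra.Module" "HOL-Algebra.AbelCoset"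
begin

text \<open>
  The library's locale \<open>module\<close> asks for a commutative ring of scalars, so it is not usable
  here; its record type and its locale \<open>submodule\<close> are, since they do not mention commutativity.
  The fields \<open>mult\<close> and \<open>one\<close> that a module record inherits from \<open>ring\<close> are never used.
\<close>

locale left_module = R?: ring R + M?: abelian_group M
  for R :: "('r, 'x) ring_scheme" (structure) and M :: "('r, 'm, 'y) module_scheme" (structure) +
  assumes smult_closed [simp, intro]:
      "\<lbrakk>a \<in> carrier R; x \<in> carrier M\<rbrakk> \<Longrightarrow> a \<odot>\<^bsub>M\<^esub> x \<in> carrier M"
    and smult_l_distr:
      "\<lbrakk>a \<in> carrier R; b \<in> carrier R; x \<in> carrier M\<rbrakk> \<Longrightarrow>
        (a \<oplus>\<^bsub>R\<^esub> b) \<odot>\<^bsub>M\<^esub> x = a \<odot>\<^bsub>M\<^esub> x \<oplus>\<^bsub>M\<^esub> b \<odot>\<^bsub>M\<^esub> x"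
    and smult_r_distr:
      "\<lbrakk>a \<in> carrier R; x \<in> carrier M; y \<in> carrier M\<rbrakk> \<Longrightarrow>
        a \<odot>\<^bsub>M\<^esub> (x \<oplus>\<^bsub>M\<^esub> y) = a \<odot>\<^bsub>M\<^esub> x \<oplus>\<^bsub>M\<^esub> a \<odot>\<^bsub>M\<^esub> y"
    and smult_assoc:
      "\<lbrakk>a \<in> carrier R; b \<in> carrier R; x \<in> carrier M\<rbrakk> \<Longrightarrow>
        (a \<otimes>\<^bsub>R\<^esub> b) \<odot>\<^bsub>M\<^esub> x = a \<odot>\<^bsub>M\<^esub> (b \<odot>\<^bsub>M\<^esub> x)"
    and smult_one [simp]:
      "x \<in> carrier M \<Longrightarrow> \<one>\<^bsub>R\<^esub> \<odot>\<^bsub>M\<^esub> x = x"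

definition nonzero_submodule ::
    "'m set \<Rightarrow> ('r, 'x) ring_scheme \<Rightarrow> ('r, 'm, 'y) module_scheme \<Rightarrow> bool" where
  "nonzero_submodule N R M \<longleftrightarrow> submodule N R M \<and> N \<noteq> {\<zero>\<^bsub>M\<^esub>}"

definition module_hom ::
    "('r, 'x) ring_scheme \<Rightarrow> ('r, 'm, 'y) module_scheme \<Rightarrow> ('r, 'n, 'z) module_scheme \<Rightarrow>
      ('m \<Rightarrow> 'n) set" where
  "module_hom R M N = {f. f \<in> carrier M \<rightarrow> carrier N \<and>
     (\<forall>x\<in>carrier M. \<forall>y\<in>carrier M. f (x \<oplus>\<^bsub>M\<^esub> y) = f x \<oplus>\<^bsub>N\<^esub> f y) \<and>
     (\<forall>r\<in>carrier R. \<forall>x\<in>carrier M. f (r \<odot>\<^bsub>M\<^esub> x) = r \<odot>\<^bsub>N\<^esub> f x)}"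

definition module_mono ::
    "('r, 'x) ring_scheme \<Rightarrow> ('r, 'm, 'y) module_scheme \<Rightarrow> ('r, 'n, 'z) module_scheme \<Rightarrow>
      ('m \<Rightarrow> 'n) set" where
  "module_mono R M N = {f \<in> module_hom R M N. inj_on f (carrier M)}"

definition quotient_module ::
    "('r, 'm, 'y) module_scheme \<Rightarrow> 'm set \<Rightarrow> ('r, 'm set) module" where
  "quotient_module M N =
     \<lparr>carrier = a_rcosets\<^bsub>M\<^esub> N, mult = undefined, one = undefined,
      zero = N, add = set_add M, smult = (\<lambda>r C. \<Union>x\<in>C. N +>\<^bsub>M\<^esub> (r \<odot>\<^bsub>M\<^esub> x))\<rparr>"

text \<open>\<open>R\<close> as a left module over itself; its submodules are the left ideals of \<open>R\<close>.\<close>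

definition regular_module :: "('r, 'x) ring_scheme \<Rightarrow> ('r, 'r) module" where
  "regular_module R =
     \<lparr>carrier = carrier R, mult = mult R, one = one R,
      zero = zero R, add = add R, smult = mult R\<rparr>"

definition compressible ::
    "('r, 'x) ring_scheme \<Rightarrow> ('r, 'm, 'y) module_scheme \<Rightarrow> bool" where
  "compressible R M \<longleftrightarrow> carrier M \<noteq> {\<zero>\<^bsub>M\<^esub>} \<and>
     (\<forall>N. nonzero_submodule N R M \<longrightarrow> (\<exists>f. f \<in> module_mono R M (M\<lparr>carrier := N\<rparr>)))"

definition critically_compressible ::
    "('r, 'x) ring_scheme \<Rightarrow> ('r, 'm, 'y) module_scheme \<Rightarrow> bool" where
  "critically_compressible R M \<longleftrightarrow> compressible R M \<and>
     (\<forall>N. nonzero_submodule N R M \<longrightarrow> \<not> (\<exists>f. f \<in> module_mono R M (quotient_module M N)))"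

definition uniform_module ::
    "('r, 'x) ring_scheme \<Rightarrow> ('r, 'm, 'y) module_scheme \<Rightarrow> bool" where
  "uniform_module R M \<longleftrightarrow>
     (\<forall>N L. nonzero_submodule N R M \<and> nonzero_submodule L R M \<longrightarrow> N \<inter> L \<noteq> {\<zero>\<^bsub>M\<^esub>})"

definition essential_submodule ::
    "'m set \<Rightarrow> ('r, 'x) ring_scheme \<Rightarrow> ('r, 'm, 'y) module_scheme \<Rightarrow> bool" where
  "essential_submodule N R M \<longleftrightarrow> submodule N R M \<and>
     (\<forall>L. nonzero_submodule L R M \<longrightarrow> N \<inter> L \<noteq> {\<zero>\<^bsub>M\<^esub>})"

definition annihilator ::
    "('r, 'x) ring_scheme \<Rightarrow> ('r, 'm, 'y) module_scheme \<Rightarrow> 'm \<Rightarrow> 'r set" where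
  "annihilator R M x = {r \<in> carrier R. r \<odot>\<^bsub>M\<^esub> x = \<zero>\<^bsub>M\<^esub>}"

definition singular_submodule ::
    "('r, 'x) ring_scheme \<Rightarrow> ('r, 'm, 'y) module_scheme \<Rightarrow> 'm set" where
  "singular_submodule R M =
     {x \<in> carrier M. essential_submodule (annihilator R M x) R (regular_module R)}"

definition nonsingular_module ::
    "('r, 'x) ring_scheme \<Rightarrow> ('r, 'm, 'y) module_scheme \<Rightarrow> bool" where
  "nonsingular_module R M \<longleftrightarrow> singular_submodule R M = {\<zero>\<^bsub>M\<^esub>}"

definition indecomposable_module ::
    "('r, 'x) ring_scheme \<Rightarrow> ('r, 'm, 'y) module_scheme \<Rightarrow> bool" where
  "indecomposable_module R M \<longleftrightarrow> carrier M \<noteq> {\<zero>\<^bsub>M\<^esub>} \<and>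
     (\<forall>A B. submodule A R M \<and> submodule B R M \<and>
        A <+>\<^bsub>M\<^esub> B = carrier M \<and> A \<inter> B = {\<zero>\<^bsub>M\<^esub>} \<longrightarrow> A = {\<zero>\<^bsub>M\<^esub>} \<or> B = {\<zero>\<^bsub>M\<^esub>})"

text \<open>
  A partial endomorphism is a pair of a submodule \<open>N\<close> and a homomorphism \<open>f\<close> defined on it;
  only the values of \<open>f\<close> on \<open>N\<close> matter.
\<close>

definition partial_endomorphism ::
    "('r, 'x) ring_scheme \<Rightarrow> ('r, 'm, 'y) module_scheme \<Rightarrow> 'm set \<Rightarrow> ('m \<Rightarrow> 'm) \<Rightarrow> bool" where
  "partial_endomorphism R M N f \<longleftrightarrow>
     submodule N R M \<and> f \<in> module_hom R (M\<lparr>carrier := N\<rparr>) M"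

text \<open>
  HOL cannot quantify over the types of the test modules inside a definition, so \<open>A\<close> and \<open>B\<close>
  range over all modules carried by subsets of \<open>'r + 'm\<close>, a type containing copies of all
  submodules of \<open>R\<close> and of \<open>M\<close>. The restriction is harmless: \<open>injective_module_extends\<close> below
  derives the extension property for test modules of arbitrary types.
\<close>

definition injective_module ::
    "('r, 'x) ring_scheme \<Rightarrow> ('r, 'm, 'y) module_scheme \<Rightarrow> bool" where
  "injective_module R M \<longleftrightarrow>
     (\<forall>(A :: ('r, 'r + 'm) module) (B :: ('r, 'r + 'm) module) i g.
        left_module R A \<and> left_module R B \<and> i \<in> module_mono R A B \<and> g \<in> module_hom R A M \<longrightarrow>
        (\<exists>h \<in> module_hom R B M. \<forall>x\<in>carrier A. h (i x) = g x))"

context left_module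
begin

lemma smult_l_null [simp]: "x \<in> carrier M \<Longrightarrow> \<zero>\<^bsub>R\<^esub> \<odot>\<^bsub>M\<^esub> x = \<zero>\<^bsub>M\<^esub>"
  using smult_l_distr[of "\<zero>\<^bsub>R\<^esub>" "\<zero>\<^bsub>R\<^esub>" x]
  by (metis M.add.r_cancel_one' R.r_zero R.zero_closed smult_closed)

lemma smult_l_minus:
  "\<lbrakk>a \<in> carrier R; x \<in> carrier M\<rbrakk> \<Longrightarrow> (\<ominus>\<^bsub>R\<^esub> a) \<odot>\<^bsub>M\<^esub> x = \<ominus>\<^bsub>M\<^esub> (a \<odot>\<^bsub>M\<^esub> x)"
  using smult_l_distr[of "\<ominus>\<^bsub>R\<^esub> a" a x]
  by (metis M.minus_equality R.add.inv_closed R.l_neg smult_closed smult_l_null)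

lemma submodule_iff:
  "submodule N R M \<longleftrightarrow> N \<subseteq> carrier M \<and> \<zero>\<^bsub>M\<^esub> \<in> N \<and>
     (\<forall>x\<in>N. \<forall>y\<in>N. x \<oplus>\<^bsub>M\<^esub> y \<in> N) \<and> (\<forall>r\<in>carrier R. \<forall>x\<in>N. r \<odot>\<^bsub>M\<^esub> x \<in> N)"
  (is "?l \<longleftrightarrow> ?r")
proof
  assume ?l
  then interpret submodule N R M .
  show ?r using subset m_closed one_closed smult_closed by auto
next
  assume N: ?r
  have "\<ominus>\<^bsub>M\<^esub> x \<in> N" if "x \<in> N" for x
  proof -
    have "x \<in> carrier M" using that N by auto
    then have "\<ominus>\<^bsub>M\<^esub> x = (\<ominus>\<^bsub>R\<^esub> \<one>\<^bsub>R\<^esub>) \<odot>\<^bsub>M\<^esub> x" by (simp add: smult_l_minus)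
    then show ?thesis using that N by auto
  qed
  then show ?l using N
    by (auto simp: submodule_def submodule_axioms_def subgroup_def a_inv_def)
qed

end

lemma left_module_regular_module: "ring R \<Longrightarrow> left_module R (regular_module R)"
  unfolding left_module_def left_module_axioms_def regular_module_def
proof (intro conjI)
  assume "ring R"
  then interpret ring R .
  show "abelian_group \<lparr>carrier = carrier R, mult = mult R, one = one R,
      zero = zero R, add = add R, smult = mult R\<rparr>"
    by (rule abelian_groupI) (auto simp: a_ac intro: l_neg)
qed (auto simp: ring.ring_simprules)

lemma left_module_quotient_module:
  assumes "left_module R M" "submodule N R M"
  shows "left_module R (quotient_module M N)"
proof -
  interpret left_module R M by fact
  interpret N: submodule N R M by fact
  interpret N: abelian_subgroup N M
    by (rule abelian_subgroupI3)
      (auto simp: additive_subgroup_def N.subgroup_axioms M.abelian_group_axioms)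
  let ?Q = "quotient_module M N"
  have coset: "X \<in> carrier ?Q \<longleftrightarrow> (\<exists>x\<in>carrier M. X = N +>\<^bsub>M\<^esub> x)" for X
    by (auto simp: quotient_module_def A_RCOSETS_def')
  have add: "(N +>\<^bsub>M\<^esub> x) \<oplus>\<^bsub>?Q\<^esub> (N +>\<^bsub>M\<^esub> y) = N +>\<^bsub>M\<^esub> (x \<oplus>\<^bsub>M\<^esub> y)"
    if "x \<in> carrier M" "y \<in> carrier M" for x y
    using that by (simp add: quotient_module_def N.a_rcos_sum)
  have zero: "\<zero>\<^bsub>?Q\<^esub> = N +>\<^bsub>M\<^esub> \<zero>\<^bsub>M\<^esub>"
    by (simp add: quotient_module_def N.a_subset)
  have smult: "r \<odot>\<^bsub>?Q\<^esub> (N +>\<^bsub>M\<^esub> x) = N +>\<^bsub>M\<^esub> (r \<odot>\<^bsub>M\<^esub> x)"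
    if r: "r \<in> carrier R" and x: "x \<in> carrier M" for r x
  proof -
    have "N +>\<^bsub>M\<^esub> (r \<odot>\<^bsub>M\<^esub> c) = N +>\<^bsub>M\<^esub> (r \<odot>\<^bsub>M\<^esub> x)" if "c \<in> N +>\<^bsub>M\<^esub> x" for c
    proof -
      obtain n where n: "n \<in> N" "c = n \<oplus>\<^bsub>M\<^esub> x"
        using \<open>c \<in> N +>\<^bsub>M\<^esub> x\<close> by (auto simp: a_r_coset_def')
      then have "n \<in> carrier M" using N.a_subset by auto
      then have "r \<odot>\<^bsub>M\<^esub> c = r \<odot>\<^bsub>M\<^esub> n \<oplus>\<^bsub>M\<^esub> r \<odot>\<^bsub>M\<^esub> x"
        using n r x by (simp add: smult_r_distr)
      moreover have "r \<odot>\<^bsub>M\<^esub> n \<in> N" using n r by (rule_tac N.smult_closed)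
      ultimately have "r \<odot>\<^bsub>M\<^esub> c \<in> N +>\<^bsub>M\<^esub> (r \<odot>\<^bsub>M\<^esub> x)"
        by (auto simp: a_r_coset_def')
      then show ?thesis
        using r x by (metis N.a_repr_independence' smult_closed)
    qed
    moreover have "N +>\<^bsub>M\<^esub> x \<noteq> {}" using x N.a_rcos_self by auto
    ultimately show ?thesis by (auto simp: quotient_module_def)
  qed
  have group: "abelian_group ?Q"
  proof (rule abelian_groupI)
    fix X assume "X \<in> carrier ?Q"
    then obtain x where x: "x \<in> carrier M" "X = N +>\<^bsub>M\<^esub> x" by (auto simp: coset)
    then show "\<exists>Y\<in>carrier ?Q. Y \<oplus>\<^bsub>?Q\<^esub> X = \<zero>\<^bsub>?Q\<^esub>"
      by (intro bexI[of _ "N +>\<^bsub>M\<^esub> (\<ominus>\<^bsub>M\<^esub> x)"])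
        (auto simp: coset add zero M.l_neg)
  qed (auto simp: coset add zero M.a_ac)
  show ?thesis
    unfolding left_module_def left_module_axioms_def
    using group
    by (auto simp: coset add smult smult_l_distr smult_r_distr smult_assoc R.ring_axioms)
qed

lemma injective_module_ideal:
  fixes R :: "('r, 'x) ring_scheme" and M :: "('r, 'm, 'y) module_scheme"
  assumes "left_module R M" "injective_module R M"
    and I: "submodule I R (regular_module R)"
    and g: "g \<in> module_hom R ((regular_module R)\<lparr>carrier := I\<rparr>) M"
  shows "\<exists>m\<in>carrier M. \<forall>r\<in>I. g r = r \<odot>\<^bsub>M\<^esub> m"
proof -
  interpret left_module R M by fact
  define C :: "'r set \<Rightarrow> ('r, 'r + 'm) module" where
    "C J = \<lparr>carrier = Inl ` J, mult = undefined, one = undefined, zero = Inl \<zero>\<^bsub>R\<^esub>,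
            add = (\<lambda>x y. Inl (projl x \<oplus>\<^bsub>R\<^esub> projl y)), smult = (\<lambda>r x. Inl (r \<otimes>\<^bsub>R\<^esub> projl x))\<rparr>" for J
  interpret reg: left_module R "regular_module R"
    by (rule left_module_regular_module) (rule R.ring_axioms)
  have C: "left_module R (C J)" if "submodule J R (regular_module R)" for J
  proof -
    have J: "J \<subseteq> carrier R" "\<zero>\<^bsub>R\<^esub> \<in> J" "\<And>x y. x \<in> J \<Longrightarrow> y \<in> J \<Longrightarrow> x \<oplus>\<^bsub>R\<^esub> y \<in> J"
      "\<And>r x. r \<in> carrier R \<Longrightarrow> x \<in> J \<Longrightarrow> r \<otimes>\<^bsub>R\<^esub> x \<in> J"
      using that unfolding reg.submodule_iff by (auto simp: regular_module_def)
    have neg: "\<ominus>\<^bsub>R\<^esub> x \<in> J" if "x \<in> J" for x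
      using J(4)[of "\<ominus>\<^bsub>R\<^esub> \<one>\<^bsub>R\<^esub>" x] that J(1) by (auto simp: R.l_minus)
    have "abelian_group (C J)"
    proof (rule abelian_groupI)
      fix X assume "X \<in> carrier (C J)"
      then show "\<exists>Y\<in>carrier (C J). Y \<oplus>\<^bsub>C J\<^esub> X = \<zero>\<^bsub>C J\<^esub>"
      proof -
        obtain x where x: "X = Inl x" "x \<in> J" using \<open>X \<in> carrier (C J)\<close> by (auto simp: C_def)
        then show ?thesis
          using J(1) neg[of x] by (intro bexI[of _ "Inl (\<ominus>\<^bsub>R\<^esub> x)"]) (auto simp: C_def R.l_neg)
      qed
    qed (use J in \<open>auto simp: C_def R.a_ac subset_iff\<close>)
    then show ?thesis
      unfolding left_module_def left_module_axioms_def
      using J by (auto simp: C_def R.ring_axioms R.l_distr R.r_distr R.m_assoc subset_iff)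
  qed
  have RC: "left_module R (C (carrier R))"
    by (rule C) (simp add: reg.submodule_iff, simp add: regular_module_def)
  have IR: "I \<subseteq> carrier R"
    using I unfolding reg.submodule_iff by (auto simp: regular_module_def)
  have "id \<in> module_mono R (C I) (C (carrier R))"
    using IR by (auto simp: module_mono_def module_hom_def C_def)
  moreover have "g \<circ> projl \<in> module_hom R (C I) M"
    using g by (auto simp: module_hom_def C_def regular_module_def)
  ultimately obtain h where h: "h \<in> module_hom R (C (carrier R)) M"
    and hg: "\<forall>x\<in>carrier (C I). h (id x) = (g \<circ> projl) x"
    using \<open>injective_module R M\<close>[unfolded injective_module_def] C[OF I] RC by blast
  have "g r = r \<odot>\<^bsub>M\<^esub> h (Inl \<one>\<^bsub>R\<^esub>)" if "r \<in> I" for r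
  proof -
    have r: "r \<in> carrier R" using that IR by auto
    have "g r = h (Inl r)" using hg that by (auto simp: C_def)
    also have "Inl r = r \<odot>\<^bsub>C (carrier R)\<^esub> Inl \<one>\<^bsub>R\<^esub>" using r by (simp add: C_def)
    also have "h \<dots> = r \<odot>\<^bsub>M\<^esub> h (Inl \<one>\<^bsub>R\<^esub>)"
      using h r unfolding module_hom_def by (simp add: C_def del: R.r_one)
    finally show ?thesis .
  qed
  moreover have "h (Inl \<one>\<^bsub>R\<^esub>) \<in> carrier M"
    using h by (auto simp: module_hom_def C_def)
  ultimately show ?thesis by blast
qed

theorem injective_module_extends:
  fixes R :: "('r, 'x) ring_scheme" and M :: "('r, 'm, 'y) module_scheme"
    and A :: "('r, 'a, 'u) module_scheme" and B :: "('r, 'b, 'v) module_scheme"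
  assumes "left_module R M" "injective_module R M" "left_module R A" "left_module R B"
    and i: "i \<in> module_mono R A B" and g: "g \<in> module_hom R A M"
  shows "\<exists>h \<in> module_hom R B M. \<forall>x\<in>carrier A. h (i x) = g x"
proof -
  interpret left_module R M by fact
  interpret A: left_module R A by fact
  interpret B: left_module R B by fact
  have i': "i x \<in> carrier B" "i (x \<oplus>\<^bsub>A\<^esub> y) = i x \<oplus>\<^bsub>B\<^esub> i y" "i (r \<odot>\<^bsub>A\<^esub> x) = r \<odot>\<^bsub>B\<^esub> i x"
    if "x \<in> carrier A" "y \<in> carrier A" "r \<in> carrier R" for x y r
    using i that by (auto simp: module_mono_def module_hom_def)
  have inj: "inj_on i (carrier A)" using i by (simp add: module_mono_def)
  have g': "g x \<in> carrier M" "g (x \<oplus>\<^bsub>A\<^esub> y) = g x \<oplus>\<^bsub>M\<^esub> g y" "g (r \<odot>\<^bsub>A\<^esub> x) = r \<odot>\<^bsub>M\<^esub> g x"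
    if "x \<in> carrier A" "y \<in> carrier A" "r \<in> carrier R" for x y r
    using g that by (auto simp: module_hom_def)
  have g0: "g \<zero>\<^bsub>A\<^esub> = \<zero>\<^bsub>M\<^esub>"
    using g'(1)[of "\<zero>\<^bsub>A\<^esub>" "\<zero>\<^bsub>A\<^esub>" "\<zero>\<^bsub>R\<^esub>"] g'(3)[of "\<zero>\<^bsub>A\<^esub>" "\<zero>\<^bsub>A\<^esub>" "\<zero>\<^bsub>R\<^esub>"] by simp
  have i0: "i \<zero>\<^bsub>A\<^esub> = \<zero>\<^bsub>B\<^esub>"
    using i'(1)[of "\<zero>\<^bsub>A\<^esub>" "\<zero>\<^bsub>A\<^esub>" "\<zero>\<^bsub>R\<^esub>"] i'(3)[of "\<zero>\<^bsub>A\<^esub>" "\<zero>\<^bsub>A\<^esub>" "\<zero>\<^bsub>R\<^esub>"] by simp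
  define G0 where "G0 = (\<lambda>a. (i a, g a)) ` carrier A"
  define P where "P G \<longleftrightarrow> G0 \<subseteq> G \<and> G \<subseteq> carrier B \<times> carrier M \<and>
     (\<forall>b x b' x'. (b, x) \<in> G \<longrightarrow> (b', x') \<in> G \<longrightarrow> (b \<oplus>\<^bsub>B\<^esub> b', x \<oplus>\<^bsub>M\<^esub> x') \<in> G) \<and>
     (\<forall>r b x. r \<in> carrier R \<longrightarrow> (b, x) \<in> G \<longrightarrow> (r \<odot>\<^bsub>B\<^esub> b, r \<odot>\<^bsub>M\<^esub> x) \<in> G) \<and>
     (\<forall>x. (\<zero>\<^bsub>B\<^esub>, x) \<in> G \<longrightarrow> x = \<zero>\<^bsub>M\<^esub>)" for G
  have P_add: "(b \<oplus>\<^bsub>B\<^esub> b', x \<oplus>\<^bsub>M\<^esub> x') \<in> G" if "P G" "(b, x) \<in> G" "(b', x') \<in> G" for G b x b' x'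
    using that unfolding P_def by blast
  have P_smult: "(r \<odot>\<^bsub>B\<^esub> b, r \<odot>\<^bsub>M\<^esub> x) \<in> G" if "P G" "r \<in> carrier R" "(b, x) \<in> G" for G r b x
    using that unfolding P_def by blast
  have P0: "P G0"
    unfolding P_def
  proof (intro conjI allI impI)
    show "G0 \<subseteq> carrier B \<times> carrier M"
      using i'(1)[OF _ A.zero_closed R.zero_closed] g'(1)[OF _ A.zero_closed R.zero_closed]
      by (auto simp: G0_def)
  next
    fix b x b' x' assume "(b, x) \<in> G0" "(b', x') \<in> G0"
    then obtain a a' where "a \<in> carrier A" "a' \<in> carrier A" "b = i a" "x = g a" "b' = i a'" "x' = g a'"
      by (auto simp: G0_def)
    then show "(b \<oplus>\<^bsub>B\<^esub> b', x \<oplus>\<^bsub>M\<^esub> x') \<in> G0"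
      unfolding G0_def
      by (intro image_eqI[of _ _ "a \<oplus>\<^bsub>A\<^esub> a'"])
        (auto simp: i'(2)[OF _ _ R.zero_closed] g'(2)[OF _ _ R.zero_closed])
  next
    fix r b x assume "r \<in> carrier R" "(b, x) \<in> G0"
    then obtain a where "a \<in> carrier A" "b = i a" "x = g a" by (auto simp: G0_def)
    then show "(r \<odot>\<^bsub>B\<^esub> b, r \<odot>\<^bsub>M\<^esub> x) \<in> G0"
      unfolding G0_def using \<open>r \<in> carrier R\<close>
      by (intro image_eqI[of _ _ "r \<odot>\<^bsub>A\<^esub> a"])
        (auto simp: i'(3)[OF _ A.zero_closed] g'(3)[OF _ A.zero_closed])
  next
    fix x assume "(\<zero>\<^bsub>B\<^esub>, x) \<in> G0"
    then obtain a where a: "a \<in> carrier A" "\<zero>\<^bsub>B\<^esub> = i a" "x = g a" by (auto simp: G0_def)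
    then have "a = \<zero>\<^bsub>A\<^esub>" using inj i0 by (metis A.zero_closed inj_onD)
    then show "x = \<zero>\<^bsub>M\<^esub>" using a g0 by simp
  qed simp
  have chain: "\<Union>C \<in> Collect P" if "C \<noteq> {}" and C: "subset.chain (Collect P) C" for C
  proof -
    have mem: "P G" if "G \<in> C" for G using C that by (auto simp: subset.chain_def)
    have two: "\<exists>G\<in>C. p \<in> G \<and> q \<in> G" if pq: "p \<in> \<Union>C" "q \<in> \<Union>C" for p q
    proof -
      obtain G H where GH: "G \<in> C" "H \<in> C" "p \<in> G" "q \<in> H" using pq by auto
      then have "G \<subseteq> H \<or> H \<subseteq> G" using C unfolding subset_chain_def by blast
      then show ?thesis using GH by blast
    qed
    have "P (\<Union>C)"
      unfolding P_def
    proof (intro conjI allI impI)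
      have "G0 \<subseteq> G" if "G \<in> C" for G using mem[OF that] unfolding P_def by simp
      then show "G0 \<subseteq> \<Union>C" using \<open>C \<noteq> {}\<close> by blast
      have "G \<subseteq> carrier B \<times> carrier M" if "G \<in> C" for G using mem[OF that] unfolding P_def by simp
      then show "\<Union>C \<subseteq> carrier B \<times> carrier M" by blast
    next
      fix b x b' x' assume "(b, x) \<in> \<Union>C" "(b', x') \<in> \<Union>C"
      then obtain G where "G \<in> C" "(b, x) \<in> G" "(b', x') \<in> G" using two by blast
      then show "(b \<oplus>\<^bsub>B\<^esub> b', x \<oplus>\<^bsub>M\<^esub> x') \<in> \<Union>C"
        using P_add[OF mem] by blast
    next
      fix r b x assume "r \<in> carrier R" "(b, x) \<in> \<Union>C"
      then obtain G where "G \<in> C" "(b, x) \<in> G" by blast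
      then show "(r \<odot>\<^bsub>B\<^esub> b, r \<odot>\<^bsub>M\<^esub> x) \<in> \<Union>C"
        using P_smult[OF mem \<open>r \<in> carrier R\<close>] by blast
    next
      fix x assume "(\<zero>\<^bsub>B\<^esub>, x) \<in> \<Union>C"
      then obtain G where "G \<in> C" "(\<zero>\<^bsub>B\<^esub>, x) \<in> G" by blast
      then show "x = \<zero>\<^bsub>M\<^esub>" using mem[of G] unfolding P_def by blast
    qed
    then show ?thesis by simp
  qed
  obtain G where G: "P G" and max: "\<And>H. P H \<Longrightarrow> G \<subseteq> H \<Longrightarrow> H = G"
    using subset_Zorn_nonempty[of "Collect P"] P0 chain by blast
  have Gc: "b \<in> carrier B" "x \<in> carrier M" if "(b, x) \<in> G" for b x
    using G that unfolding P_def by auto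
  have Ga: "(b \<oplus>\<^bsub>B\<^esub> b', x \<oplus>\<^bsub>M\<^esub> x') \<in> G" if "(b, x) \<in> G" "(b', x') \<in> G" for b x b' x'
    using P_add[OF G that] .
  have Gs: "(r \<odot>\<^bsub>B\<^esub> b, r \<odot>\<^bsub>M\<^esub> x) \<in> G" if "r \<in> carrier R" "(b, x) \<in> G" for r b x
    using P_smult[OF G that] .
  have Gz: "x = \<zero>\<^bsub>M\<^esub>" if "(\<zero>\<^bsub>B\<^esub>, x) \<in> G" for x
    using G that unfolding P_def by blast
  have G00: "G0 \<subseteq> G" using G unfolding P_def by blast
  have zG: "(\<zero>\<^bsub>B\<^esub>, \<zero>\<^bsub>M\<^esub>) \<in> G"
    using G00 i0 g0 unfolding G0_def by (force intro: image_eqI[of _ _ "\<zero>\<^bsub>A\<^esub>"])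
  have Gn: "(\<ominus>\<^bsub>B\<^esub> b, \<ominus>\<^bsub>M\<^esub> x) \<in> G" if "(b, x) \<in> G" for b x
    using Gs[of "\<ominus>\<^bsub>R\<^esub> \<one>\<^bsub>R\<^esub>", OF _ that] Gc[OF that] by (simp add: smult_l_minus B.smult_l_minus)
  have Gu: "x = x'" if "(b, x) \<in> G" "(b, x') \<in> G" for b x x'
  proof -
    have "(b \<oplus>\<^bsub>B\<^esub> \<ominus>\<^bsub>B\<^esub> b, x \<oplus>\<^bsub>M\<^esub> \<ominus>\<^bsub>M\<^esub> x') \<in> G" using that Ga Gn by blast
    then have "x \<oplus>\<^bsub>M\<^esub> \<ominus>\<^bsub>M\<^esub> x' = \<zero>\<^bsub>M\<^esub>" using Gz Gc[OF that(1)] by (simp add: B.r_neg)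
    then show ?thesis using Gc[OF that(1)] Gc[OF that(2)]
      by (metis M.add.inv_closed M.minus_equality M.minus_minus)
  qed
  have total: "\<exists>x. (b, x) \<in> G" if b: "b \<in> carrier B" for b
  proof -
    define I where "I = {r \<in> carrier R. \<exists>x. (r \<odot>\<^bsub>B\<^esub> b, x) \<in> G}"
    define f where "f r = (THE x. (r \<odot>\<^bsub>B\<^esub> b, x) \<in> G)" for r
    have f_eq: "f r = x" if "(r \<odot>\<^bsub>B\<^esub> b, x) \<in> G" for r x
      unfolding f_def using that Gu by blast
    interpret reg: left_module R "regular_module R"
      by (rule left_module_regular_module) (rule R.ring_axioms)
    have I: "submodule I R (regular_module R)"
      unfolding reg.submodule_iff
    proof (intro conjI ballI)
      show "I \<subseteq> carrier (regular_module R)" by (auto simp: I_def regular_module_def)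
      show "\<zero>\<^bsub>regular_module R\<^esub> \<in> I" using zG b by (auto simp: I_def regular_module_def)
    next
      fix x y assume "x \<in> I" "y \<in> I"
      then show "x \<oplus>\<^bsub>regular_module R\<^esub> y \<in> I"
        using b Ga by (force simp: I_def regular_module_def B.smult_l_distr)
    next
      fix r x assume "r \<in> carrier R" "x \<in> I"
      then show "r \<odot>\<^bsub>regular_module R\<^esub> x \<in> I"
        using b Gs by (force simp: I_def regular_module_def B.smult_assoc)
    qed
    have f: "f \<in> module_hom R ((regular_module R)\<lparr>carrier := I\<rparr>) M"
      unfolding module_hom_def
    proof (intro CollectI conjI ballI funcsetI)
      fix r assume "r \<in> carrier ((regular_module R)\<lparr>carrier := I\<rparr>)"
      then show "f r \<in> carrier M" using Gc f_eq by (auto simp: I_def)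
    next
      fix r s
      assume "r \<in> carrier ((regular_module R)\<lparr>carrier := I\<rparr>)"
        "s \<in> carrier ((regular_module R)\<lparr>carrier := I\<rparr>)"
      then obtain x y where rs: "r \<in> carrier R" "s \<in> carrier R" and
        xy: "(r \<odot>\<^bsub>B\<^esub> b, x) \<in> G" "(s \<odot>\<^bsub>B\<^esub> b, y) \<in> G"
        by (auto simp: I_def)
      have "((r \<oplus>\<^bsub>R\<^esub> s) \<odot>\<^bsub>B\<^esub> b, x \<oplus>\<^bsub>M\<^esub> y) \<in> G"
        using Ga[OF xy] rs b by (simp add: B.smult_l_distr)
      then show "f (r \<oplus>\<^bsub>(regular_module R)\<lparr>carrier := I\<rparr>\<^esub> s) = f r \<oplus>\<^bsub>M\<^esub> f s"
        using xy by (simp add: regular_module_def f_eq)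
    next
      fix r s
      assume r: "r \<in> carrier R" and "s \<in> carrier ((regular_module R)\<lparr>carrier := I\<rparr>)"
      then obtain y where s: "s \<in> carrier R" and y: "(s \<odot>\<^bsub>B\<^esub> b, y) \<in> G"
        by (auto simp: I_def)
      have "((r \<otimes>\<^bsub>R\<^esub> s) \<odot>\<^bsub>B\<^esub> b, r \<odot>\<^bsub>M\<^esub> y) \<in> G"
        using Gs[OF r y] r s b by (simp add: B.smult_assoc)
      then show "f (r \<odot>\<^bsub>(regular_module R)\<lparr>carrier := I\<rparr>\<^esub> s) = r \<odot>\<^bsub>M\<^esub> f s"
        using y by (simp add: regular_module_def f_eq)
    qed
    obtain m where m: "m \<in> carrier M" and fm: "\<And>r. r \<in> I \<Longrightarrow> f r = r \<odot>\<^bsub>M\<^esub> m"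
      using injective_module_ideal[OF assms(1,2) I f] by blast
    have Gm: "x = r \<odot>\<^bsub>M\<^esub> m" if "r \<in> carrier R" "(r \<odot>\<^bsub>B\<^esub> b, x) \<in> G" for r x
      using fm[of r] f_eq[OF that(2)] that by (auto simp: I_def)
    define H where
      "H = {(d \<oplus>\<^bsub>B\<^esub> r \<odot>\<^bsub>B\<^esub> b, x \<oplus>\<^bsub>M\<^esub> r \<odot>\<^bsub>M\<^esub> m) | d x r. (d, x) \<in> G \<and> r \<in> carrier R}"
    have GH: "G \<subseteq> H"
    proof
      fix p assume "p \<in> G"
      then obtain d x where p: "p = (d, x)" "(d, x) \<in> G" by (cases p) auto
      then have "p = (d \<oplus>\<^bsub>B\<^esub> \<zero>\<^bsub>R\<^esub> \<odot>\<^bsub>B\<^esub> b, x \<oplus>\<^bsub>M\<^esub> \<zero>\<^bsub>R\<^esub> \<odot>\<^bsub>M\<^esub> m)"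
        using Gc[OF p(2)] b m by simp
      then show "p \<in> H" using p(2) unfolding H_def by blast
    qed
    have "P H"
      unfolding P_def
    proof (intro conjI allI impI)
      show "G0 \<subseteq> H" using G00 GH by blast
      show "H \<subseteq> carrier B \<times> carrier M" using Gc b m by (auto simp: H_def)
    next
      fix c x c' x' assume "(c, x) \<in> H" "(c', x') \<in> H"
      then obtain d y r d' y' r' where
        *: "(d, y) \<in> G" "r \<in> carrier R" "c = d \<oplus>\<^bsub>B\<^esub> r \<odot>\<^bsub>B\<^esub> b" "x = y \<oplus>\<^bsub>M\<^esub> r \<odot>\<^bsub>M\<^esub> m"
          "(d', y') \<in> G" "r' \<in> carrier R" "c' = d' \<oplus>\<^bsub>B\<^esub> r' \<odot>\<^bsub>B\<^esub> b" "x' = y' \<oplus>\<^bsub>M\<^esub> r' \<odot>\<^bsub>M\<^esub> m"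
        unfolding H_def by blast
      have "c \<oplus>\<^bsub>B\<^esub> c' = (d \<oplus>\<^bsub>B\<^esub> d') \<oplus>\<^bsub>B\<^esub> (r \<oplus>\<^bsub>R\<^esub> r') \<odot>\<^bsub>B\<^esub> b"
        "x \<oplus>\<^bsub>M\<^esub> x' = (y \<oplus>\<^bsub>M\<^esub> y') \<oplus>\<^bsub>M\<^esub> (r \<oplus>\<^bsub>R\<^esub> r') \<odot>\<^bsub>M\<^esub> m"
        using * b m Gc[OF *(1)] Gc[OF *(5)]
        by (simp_all add: smult_l_distr B.smult_l_distr M.a_ac B.a_ac)
      then show "(c \<oplus>\<^bsub>B\<^esub> c', x \<oplus>\<^bsub>M\<^esub> x') \<in> H"
        unfolding H_def using Ga[OF *(1,5)] R.a_closed[OF *(2,6)] by blast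
    next
      fix s c x assume s: "s \<in> carrier R" and "(c, x) \<in> H"
      then obtain d y r where
        *: "(d, y) \<in> G" "r \<in> carrier R" "c = d \<oplus>\<^bsub>B\<^esub> r \<odot>\<^bsub>B\<^esub> b" "x = y \<oplus>\<^bsub>M\<^esub> r \<odot>\<^bsub>M\<^esub> m"
        unfolding H_def by blast
      have "s \<odot>\<^bsub>B\<^esub> c = s \<odot>\<^bsub>B\<^esub> d \<oplus>\<^bsub>B\<^esub> (s \<otimes>\<^bsub>R\<^esub> r) \<odot>\<^bsub>B\<^esub> b"
        "s \<odot>\<^bsub>M\<^esub> x = s \<odot>\<^bsub>M\<^esub> y \<oplus>\<^bsub>M\<^esub> (s \<otimes>\<^bsub>R\<^esub> r) \<odot>\<^bsub>M\<^esub> m"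
        using * s b m Gc[OF *(1)]
        by (simp_all add: smult_r_distr B.smult_r_distr smult_assoc B.smult_assoc)
      then show "(s \<odot>\<^bsub>B\<^esub> c, s \<odot>\<^bsub>M\<^esub> x) \<in> H"
        unfolding H_def using Gs[OF s *(1)] R.m_closed[OF s *(2)] by blast
    next
      fix x assume "(\<zero>\<^bsub>B\<^esub>, x) \<in> H"
      then obtain d y r where
        *: "(d, y) \<in> G" "r \<in> carrier R" "\<zero>\<^bsub>B\<^esub> = d \<oplus>\<^bsub>B\<^esub> r \<odot>\<^bsub>B\<^esub> b" "x = y \<oplus>\<^bsub>M\<^esub> r \<odot>\<^bsub>M\<^esub> m"
        unfolding H_def by blast
      note c = Gc[OF *(1)]
      have "r \<odot>\<^bsub>B\<^esub> b = \<ominus>\<^bsub>B\<^esub> d"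
        using *(2,3) c b by (metis B.M.minus_equality B.M.minus_minus B.smult_closed)
      then have "(r \<odot>\<^bsub>B\<^esub> b, \<ominus>\<^bsub>M\<^esub> y) \<in> G" using Gn[OF *(1)] by simp
      then have "\<ominus>\<^bsub>M\<^esub> y = r \<odot>\<^bsub>M\<^esub> m" using Gm *(2) by blast
      then show "x = \<zero>\<^bsub>M\<^esub>" using *(4) c by (metis M.r_neg)
    qed
    then have "H = G" using max GH by blast
    moreover have "(\<zero>\<^bsub>B\<^esub> \<oplus>\<^bsub>B\<^esub> \<one>\<^bsub>R\<^esub> \<odot>\<^bsub>B\<^esub> b, \<zero>\<^bsub>M\<^esub> \<oplus>\<^bsub>M\<^esub> \<one>\<^bsub>R\<^esub> \<odot>\<^bsub>M\<^esub> m) \<in> H"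
      unfolding H_def using zG R.one_closed by blast
    ultimately show ?thesis by (metis B.M.l_zero B.smult_one b)
  qed
  define h where "h b = (THE x. (b, x) \<in> G)" for b
  have h_eq: "h b = x" if "(b, x) \<in> G" for b x
    unfolding h_def using that Gu by blast
  have hG: "(b, h b) \<in> G" if "b \<in> carrier B" for b
    using total[OF that] h_eq by blast
  have "h \<in> module_hom R B M"
    unfolding module_hom_def
    using Gc(2)[OF hG] h_eq[OF Ga[OF hG hG]] h_eq[OF Gs[OF _ hG]] by auto
  moreover have "h (i x) = g x" if "x \<in> carrier A" for x
    using that G00 by (intro h_eq) (auto simp: G0_def)
  ultimately show ?thesis by blast
qed

end

theory Submission
  imports Defs
begin

text \<open>
  A monomorphism \<open>f\<close> from an injective module \<open>M\<close> to itself splits, so if \<open>M\<close> is indecomposable then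
  \<open>f\<close> is onto. A compressible module embeds in each of its nonzero submodules, so here every nonzero
  submodule is all of \<open>M\<close>: the module is simple. Its only quotient by a nonzero submodule is
  zero, which cannot contain a copy of \<open>M\<close>.
\<close>

lemma (in left_module) smult_r_null: "r \<in> carrier R \<Longrightarrow> r \<odot>\<^bsub>M\<^esub> \<zero>\<^bsub>M\<^esub> = \<zero>\<^bsub>M\<^esub>"
  by (metis M.zero_closed R.r_null R.zero_closed smult_assoc smult_l_null)

lemma (in left_module) module_hom_endo:
  assumes "f \<in> module_hom R M M"
  shows "x \<in> carrier M \<Longrightarrow> f x \<in> carrier M"
    and "x \<in> carrier M \<Longrightarrow> y \<in> carrier M \<Longrightarrow> f (x \<oplus>\<^bsub>M\<^esub> y) = f x \<oplus>\<^bsub>M\<^esub> f y"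
    and "r \<in> carrier R \<Longrightarrow> x \<in> carrier M \<Longrightarrow> f (r \<odot>\<^bsub>M\<^esub> x) = r \<odot>\<^bsub>M\<^esub> f x"
    and "f \<zero>\<^bsub>M\<^esub> = \<zero>\<^bsub>M\<^esub>"
    and "x \<in> carrier M \<Longrightarrow> f (\<ominus>\<^bsub>M\<^esub> x) = \<ominus>\<^bsub>M\<^esub> f x"
proof -
  show closed: "f x \<in> carrier M" if "x \<in> carrier M" for x
    using assms that by (auto simp: module_hom_def)
  show add: "f (x \<oplus>\<^bsub>M\<^esub> y) = f x \<oplus>\<^bsub>M\<^esub> f y" if "x \<in> carrier M" "y \<in> carrier M" for x y
    using assms that by (auto simp: module_hom_def)
  show "f (r \<odot>\<^bsub>M\<^esub> x) = r \<odot>\<^bsub>M\<^esub> f x" if "r \<in> carrier R" "x \<in> carrier M" for r x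
    using assms that by (auto simp: module_hom_def)
  show zero: "f \<zero>\<^bsub>M\<^esub> = \<zero>\<^bsub>M\<^esub>"
    by (metis add closed M.add.r_cancel_one' M.l_zero M.zero_closed)
  show "f (\<ominus>\<^bsub>M\<^esub> x) = \<ominus>\<^bsub>M\<^esub> f x" if "x \<in> carrier M" for x
    using that by (metis add closed zero M.add.inv_closed M.l_neg M.minus_equality)
qed

text \<open>A left inverse \<open>h\<close> of \<open>f\<close> makes \<open>M\<close> the direct
  sum of the image of \<open>f\<close> and the kernel of \<open>h\<close>. Indecomposability kills
  one summand, and it cannot be the image: \<open>h\<close> recovers all of the nonzero module
  \<open>M\<close> from it.\<close>

lemma mono_endo_onto:
  fixes R :: "('r, 'x) ring_scheme" and M :: "('r, 'm, 'y) module_scheme"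
  assumes "left_module R M" "injective_module R M" "indecomposable_module R M"
    and f: "f \<in> module_mono R M M"
  shows "f ` carrier M = carrier M"
proof -
  interpret left_module R M by fact
  have hom: "f \<in> module_hom R M M" and inj: "inj_on f (carrier M)"
    using f by (auto simp: module_mono_def)
  \<comment> \<open>The identity is the map to be extended along \<open>f\<close>; its extension
    \<open>h\<close> is the left inverse.\<close>
  have "(\<lambda>x. x) \<in> module_hom R M M" by (auto simp: module_hom_def)
  then obtain h where h: "h \<in> module_hom R M M" and hf: "\<And>x. x \<in> carrier M \<Longrightarrow> h (f x) = x"
    using injective_module_extends[OF assms(1,2,1,1) f] by blast
  note f' = module_hom_endo[OF hom] and h' = module_hom_endo[OF h]
  define A where "A = f ` carrier M"
  define B where "B = {x \<in> carrier M. h x = \<zero>\<^bsub>M\<^esub>}"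
  have A: "submodule A R M"
    unfolding submodule_iff A_def
    by (auto simp: f'(1) image_iff f'(2)[symmetric] f'(3)[symmetric])
      (metis M.zero_closed f'(4))
  have B: "submodule B R M"
    unfolding submodule_iff B_def
    by (simp add: h' smult_r_null)
  have "x \<in> A <+>\<^bsub>M\<^esub> B" if x: "x \<in> carrier M" for x
  proof -
    \<comment> \<open>The composite of \<open>f\<close> after \<open>h\<close> is the projection
      onto \<open>A\<close> along \<open>B\<close>: since \<open>h (f (h x)) = h x\<close>, the
      remainder of \<open>x\<close> is killed by \<open>h\<close>.\<close>
    let ?y = "f (h x)"
    have y: "?y \<in> carrier M" using x by (simp add: f' h')
    have "x \<oplus>\<^bsub>M\<^esub> \<ominus>\<^bsub>M\<^esub> ?y \<in> B"
      using x y by (simp add: B_def h' hf M.r_neg)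
    moreover have "x = ?y \<oplus>\<^bsub>M\<^esub> (x \<oplus>\<^bsub>M\<^esub> \<ominus>\<^bsub>M\<^esub> ?y)"
      using x y by (simp add: M.a_lcomm M.r_neg)
    ultimately show ?thesis
      using x unfolding set_add_def' A_def by (blast intro: h'(1))
  qed
  then have sum: "A <+>\<^bsub>M\<^esub> B = carrier M"
    using f'(1) by (auto simp: set_add_def' A_def B_def)
  \<comment> \<open>If \<open>f x\<close> lies in \<open>B\<close>, then \<open>x = h (f x)\<close>
    is zero, and so is \<open>f x\<close>.\<close>
  have "A \<inter> B = {\<zero>\<^bsub>M\<^esub>}"
    using f'(4) h'(4) by (force simp: A_def B_def hf image_iff)
  then have "A = {\<zero>\<^bsub>M\<^esub>} \<or> B = {\<zero>\<^bsub>M\<^esub>}"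
    using assms(3) A B sum by (auto simp: indecomposable_module_def)
  moreover have "A \<noteq> {\<zero>\<^bsub>M\<^esub>}"
  proof
    assume "A = {\<zero>\<^bsub>M\<^esub>}"
    then have "x = \<zero>\<^bsub>M\<^esub>" if "x \<in> carrier M" for x
      using that hf[OF that] h'(4) unfolding A_def by (metis imageI singletonD)
    then show False using assms(3) by (auto simp: indecomposable_module_def)
  qed
  ultimately have "A <+>\<^bsub>M\<^esub> {\<zero>\<^bsub>M\<^esub>} = carrier M" using sum by simp
  then show ?thesis using f'(1) by (force simp: set_add_def' A_def)
qed

theorem proposition2p5:
  fixes R :: "('r, 'x) ring_scheme" and M :: "('r, 'm, 'y) module_scheme"
  assumes "left_module R M"
    and "\<one>\<^bsub>R\<^esub> \<noteq> \<zero>\<^bsub>R\<^esub>"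
    and "compressible R M"
    and "indecomposable_module R M"
    and "injective_module R M"
    and "\<And>N f. partial_endomorphism R M N f \<Longrightarrow> \<exists>x\<in>N. f x \<noteq> \<zero>\<^bsub>M\<^esub> \<Longrightarrow>
           uniform_module R (M\<lparr>carrier := a_kernel (M\<lparr>carrier := N\<rparr>) M f\<rparr>) \<and>
           nonsingular_module R (M\<lparr>carrier := a_kernel (M\<lparr>carrier := N\<rparr>) M f\<rparr>)"
  shows "critically_compressible R M"
proof -
  interpret left_module R M by fact
  have False if N: "nonzero_submodule N R M" and g: "g \<in> module_mono R M (quotient_module M N)" for N g
  proof -
    have sub: "submodule N R M" using N by (simp add: nonzero_submodule_def)
    then have NM: "N \<subseteq> carrier M" by (simp add: submodule_iff)
    obtain f where f: "f \<in> module_mono R M (M\<lparr>carrier := N\<rparr>)"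
      using assms(3) N unfolding compressible_def by blast
    \<comment> \<open>The structure on \<open>N\<close> differs from \<open>M\<close> only in its
      carrier, so the embedding into \<open>N\<close> is also an injective endomorphism of
      \<open>M\<close>. Being onto \<open>M\<close> with image inside \<open>N\<close>, it forces
      \<open>N\<close> to be everything.\<close>
    then have "f \<in> module_mono R M M" and fN: "f ` carrier M \<subseteq> N"
      using NM by (auto simp: module_mono_def module_hom_def)
    then have "N = carrier M"
      using mono_endo_onto[OF assms(1,5,4)] NM by blast
    \<comment> \<open>Each coset of the whole module is the whole module, so the quotient has at
      most one element.\<close>
    then have "carrier (quotient_module M N) \<subseteq> {carrier M}"
      using M.a_coset_join2[of _ "carrier M"] sub
      by (auto simp: quotient_module_def A_RCOSETS_def' submodule_def)
    moreover have "g ` carrier M \<subseteq> carrier (quotient_module M N)" and inj: "inj_on g (carrier M)"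
      using g by (auto simp: module_mono_def module_hom_def)
    \<comment> \<open>With a single possible value, \<open>g\<close> is constant; as it is
      injective, \<open>M\<close> would be zero, which indecomposability excludes.\<close>
    ultimately have "g x = g \<zero>\<^bsub>M\<^esub>" if "x \<in> carrier M" for x
      using that M.zero_closed by blast
    then have "carrier M = {\<zero>\<^bsub>M\<^esub>}"
      using inj M.zero_closed by (blast dest: inj_onD)
    then show False using assms(4) by (auto simp: indecomposable_module_def)
  qed
  then show ?thesis using assms(3) by (auto simp: critically_compressible_def)
qed

end
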